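(* Let $\mathbb{K}$ be an algebraically closed field of characteristic $0$ or of prime characteristic $p\ge 7$, and let $m\ge 5$ be an integer, with $m\le p-1$ if $\mathbb{K}$ has characteristic $p$. Let $V$ be the curve in $\mathrm{PG}(m-1,\mathbb{K})$ defined by $X_1^k+\cdots+X_m^k=0$ for $1\le k\le m-2$, and let $G\cong\mathrm{Sym}_m$ act on $V$ by permuting the homogeneous coordinates. Let $\varepsilon\in\mathbb{K}$ be a primitive $(m-1)$-th root of unity and let $\Omega_\varepsilon$ be the $G$-orbit of the point $P_\varepsilon=(\varepsilon:\varepsilon^2:\cdots:\varepsilon^{m-1}=1:0)$ of $V$. Then $\Omega_\varepsilon$ consists precisely of the common points of $V$ and the hypersurface of equation $$X_1^{m}+X_2^{m}+\cdots+X_m^{m}=0.$$ *)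

theory Defs
  imports
    "HOL-Algebra.Group_Action"
    "HOL-Algebra.Sym_Groups"
    "HOL-Computational_Algebra.Polynomial"
begin

section \<open>Projective space over a field\<close>

text \<open>
  A vector \<open>(x\<^sub>1, \<dots>, x\<^sub>m)\<close> is a function on \<open>nat\<close> that vanishes outside \<open>{1..m}\<close>.
  \<open>proj_space n\<close> is \<open>PG(n, K)\<close>, with the \<open>n + 1\<close> homogeneous coordinates
  \<open>X\<^sub>1, \<dots>, X\<^sub>n\<^sub>+\<^sub>1\<close>; its points are classes of nonzero vectors up to nonzero scalars.
\<close>

definition hcoords :: "nat \<Rightarrow> (nat \<Rightarrow> 'a::field) set" where
  "hcoords n = {x. (\<forall>i. i \<notin> {1..n + 1} \<longrightarrow> x i = 0) \<and> (\<exists>i\<in>{1..n + 1}. x i \<noteq> 0)}"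

definition proj_rel :: "nat \<Rightarrow> ((nat \<Rightarrow> 'a::field) \<times> (nat \<Rightarrow> 'a)) set" where
  "proj_rel n = {(x, y). x \<in> hcoords n \<and> y \<in> hcoords n \<and> (\<exists>c. c \<noteq> 0 \<and> y = (\<lambda>i. c * x i))}"

definition proj_space :: "nat \<Rightarrow> (nat \<Rightarrow> 'a::field) set set" where
  "proj_space n = hcoords n // proj_rel n"

definition proj_point :: "nat \<Rightarrow> (nat \<Rightarrow> 'a::field) \<Rightarrow> (nat \<Rightarrow> 'a) set" where
  "proj_point n x = proj_rel n `` {x}"

lemma equiv_proj_rel: "equiv (hcoords n) (proj_rel n :: ((nat \<Rightarrow> 'a::field) \<times> _) set)"
proof (rule equivI)
  show "proj_rel n \<subseteq> hcoords n \<times> (hcoords n :: (nat \<Rightarrow> 'a) set)"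
    by (auto simp: proj_rel_def)
  show "refl_on (hcoords n) (proj_rel n :: ((nat \<Rightarrow> 'a) \<times> _) set)"
    by (auto simp: refl_on_def proj_rel_def intro!: exI[of _ 1])
  show "sym (proj_rel n :: ((nat \<Rightarrow> 'a) \<times> _) set)"
  proof (rule symI)
    fix x y :: "nat \<Rightarrow> 'a" assume "(x, y) \<in> proj_rel n"
    then obtain c where "x \<in> hcoords n" "y \<in> hcoords n" "c \<noteq> 0" "y = (\<lambda>i. c * x i)"
      by (auto simp: proj_rel_def)
    then show "(y, x) \<in> proj_rel n"
      by (auto simp: proj_rel_def intro!: exI[of _ "inverse c"])
  qed
  show "trans (proj_rel n :: ((nat \<Rightarrow> 'a) \<times> _) set)"
  proof (rule transI)
    fix x y z :: "nat \<Rightarrow> 'a" assume "(x, y) \<in> proj_rel n" "(y, z) \<in> proj_rel n"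
    then obtain c d where "x \<in> hcoords n" "z \<in> hcoords n" "c \<noteq> 0" "y = (\<lambda>i. c * x i)"
      "d \<noteq> 0" "z = (\<lambda>i. d * y i)"
      by (auto simp: proj_rel_def)
    then show "(x, z) \<in> proj_rel n"
      by (auto simp: proj_rel_def mult.assoc intro!: exI[of _ "d * c"])
  qed
qed


section \<open>The curve, the hypersurface and the action of the symmetric group\<close>

text \<open>
  The equations are homogeneous, so it is immaterial whether they are required of one
  representative of \<open>P\<close> or of all of them.
\<close>

definition fermat_hypersurface :: "nat \<Rightarrow> nat \<Rightarrow> (nat \<Rightarrow> 'a::field) set set" where
  "fermat_hypersurface m k = {P \<in> proj_space (m - 1). \<forall>x\<in>P. (\<Sum>i = 1..m. x i ^ k) = 0}"

definition curve_V :: "nat \<Rightarrow> (nat \<Rightarrow> 'a::field) set set" where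
  "curve_V m = {P \<in> proj_space (m - 1). \<forall>k\<in>{1..m - 2}. \<forall>x\<in>P. (\<Sum>i = 1..m. x i ^ k) = 0}"

text \<open>
  \<open>\<sigma>\<close> moves the entry in position \<open>i\<close> to position \<open>\<sigma> i\<close>; the inverse makes this a left action.
  Following the library convention for group actions, \<open>coord_action m \<sigma>\<close> is extensional on
  the curve.
\<close>

definition coord_action ::
    "nat \<Rightarrow> (nat \<Rightarrow> nat) \<Rightarrow> (nat \<Rightarrow> 'a::field) set \<Rightarrow> (nat \<Rightarrow> 'a) set" where
  "coord_action m \<sigma> = (\<lambda>P\<in>curve_V m. (\<lambda>x. x \<circ> inv' \<sigma>) ` P)"

definition primitive_root_of_unity :: "nat \<Rightarrow> 'a::field \<Rightarrow> bool" where
  "primitive_root_of_unity n e \<longleftrightarrow> n > 0 \<and> e ^ n = 1 \<and> (\<forall>k. 0 < k \<and> k < n \<longrightarrow> e ^ k \<noteq> 1)"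

text \<open>The point \<open>(e : e\<^sup>2 : \<dots> : e\<^sup>m\<^sup>-\<^sup>1 : 0)\<close>\<close>

definition P_eps :: "nat \<Rightarrow> 'a::field \<Rightarrow> (nat \<Rightarrow> 'a) set" where
  "P_eps m e = proj_point (m - 1) (\<lambda>i. if i \<in> {1..m - 1} then e ^ i else 0)"

definition Omega_eps :: "nat \<Rightarrow> 'a::field \<Rightarrow> (nat \<Rightarrow> 'a) set set" where
  "Omega_eps m e = orbit (sym_group m) (coord_action m) (P_eps m e)"


subsection \<open>Well-definedness\<close>

lemma permute_hcoords:
  assumes "m \<ge> 1" "\<sigma> permutes {1..m}" "x \<in> hcoords (m - 1)"
  shows "x \<circ> \<sigma> \<in> hcoords (m - 1)"
proof -
  have m: "m - 1 + 1 = m" using assms(1) by simp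
  obtain j where j: "j \<in> {1..m}" "x j \<noteq> 0"
    using assms(3) unfolding hcoords_def m by blast
  then obtain i where "i \<in> {1..m}" "\<sigma> i = j"
    using permutes_image[OF assms(2)] by (metis imageE)
  with j have "\<exists>i\<in>{1..m}. (x \<circ> \<sigma>) i \<noteq> 0" by auto
  moreover have "(x \<circ> \<sigma>) i = 0" if "i \<notin> {1..m}" for i
    using assms(3) that permutes_not_in[OF assms(2) that] unfolding hcoords_def m by simp
  ultimately show ?thesis unfolding hcoords_def m by simp
qed

lemma permute_proj_space:
  fixes P :: "(nat \<Rightarrow> 'a::field) set"
  assumes m: "m \<ge> 1" and \<sigma>: "\<sigma> permutes {1..m}" and P: "P \<in> proj_space (m - 1)"
  shows "(\<lambda>x. x \<circ> \<sigma>) ` P \<in> proj_space (m - 1)"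
proof -
  obtain x where x: "x \<in> hcoords (m - 1)" "P = proj_rel (m - 1) `` {x}"
    using P by (auto simp: proj_space_def quotient_def)
  have *: "P = {(\<lambda>i. c * x i) |c. c \<noteq> 0}" if "P = proj_rel (m - 1) `` {x}" "x \<in> hcoords (m - 1)"
    for P :: "(nat \<Rightarrow> 'a) set" and x
    unfolding that(1) using that(2) by (auto simp: proj_rel_def hcoords_def)
  have x': "x \<circ> \<sigma> \<in> hcoords (m - 1)" by (rule permute_hcoords[OF m \<sigma> x(1)])
  have "(\<lambda>x. x \<circ> \<sigma>) ` P = proj_rel (m - 1) `` {x \<circ> \<sigma>}"
    unfolding *[OF x(2,1)] *[OF refl x'] by (auto simp: o_def image_iff)
  then show ?thesis using x' by (auto simp: proj_space_def quotient_def)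
qed

lemma permute_curve_V:
  fixes P :: "(nat \<Rightarrow> 'a::field) set"
  assumes m: "m \<ge> 1" and \<sigma>: "\<sigma> permutes {1..m}" and P: "P \<in> curve_V m"
  shows "(\<lambda>x. x \<circ> \<sigma>) ` P \<in> curve_V m"
proof -
  have "(\<Sum>i = 1..m. (x \<circ> \<sigma>) i ^ k) = (\<Sum>i = 1..m. x i ^ k)" for x :: "nat \<Rightarrow> 'a" and k
    using sum.permute[OF \<sigma>, of "\<lambda>i. x i ^ k"] by (simp add: o_def)
  then show ?thesis
    using P permute_proj_space[OF m \<sigma>] by (auto simp: curve_V_def)
qed

lemma group_action_coord_action:
  assumes m: "m \<ge> 1"
  shows "group_action (sym_group m) (curve_V m :: (nat \<Rightarrow> 'a::field) set set) (coord_action m)"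
proof -
  let ?V = "curve_V m :: (nat \<Rightarrow> 'a) set set"
  have clo: "coord_action m \<sigma> P \<in> ?V" if "\<sigma> permutes {1..m}" "P \<in> ?V" for \<sigma> P
    using permute_curve_V[OF m permutes_inv[OF that(1)] that(2)] that by (simp add: coord_action_def)
  have comp: "coord_action m (\<sigma> \<circ> \<tau>) P = coord_action m \<sigma> (coord_action m \<tau> P)"
    if "\<sigma> permutes {1..m}" "\<tau> permutes {1..m}" "P \<in> ?V" for \<sigma> \<tau> P
    using that clo[OF that(2,3)] o_inv_distrib[OF permutes_bij[OF that(1)] permutes_bij[OF that(2)]]
    by (simp add: coord_action_def image_image o_assoc)
  have one: "coord_action m id P = P" if "P \<in> ?V" for P
    using that by (simp add: coord_action_def inv_id)
  have bij: "coord_action m \<sigma> \<in> Bij ?V" if \<sigma>: "\<sigma> permutes {1..m}" for \<sigma>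
  proof -
    have \<sigma>': "inv' \<sigma> permutes {1..m}" by (rule permutes_inv[OF \<sigma>])
    have "bij_betw (coord_action m \<sigma>) ?V ?V"
      by (rule bij_betw_byWitness[where f' = "coord_action m (inv' \<sigma>)"])
        (use clo[OF \<sigma>] clo[OF \<sigma>'] comp[OF \<sigma> \<sigma>'] comp[OF \<sigma>' \<sigma>] one
          permutes_inv_o[OF \<sigma>] in auto)
    then show ?thesis by (simp add: Bij_def coord_action_def)
  qed
  have "coord_action m (\<sigma> \<circ> \<tau>) = compose ?V (coord_action m \<sigma>) (coord_action m \<tau>)"
    if "\<sigma> permutes {1..m}" "\<tau> permutes {1..m}" for \<sigma> \<tau>
    by (rule extensionalityI[of _ ?V])
      (use comp[OF that] in \<open>auto simp: compose_def coord_action_def\<close>)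
  then show ?thesis
    using sym_group_is_group group_BijGroup bij
    by (auto simp: group_action_def group_hom_def group_hom_axioms_def hom_def BijGroup_def
        sym_group_def)
qed

lemma P_eps_in_curve_V:
  fixes e :: "'a::field"
  assumes m: "m \<ge> 5" and e: "primitive_root_of_unity (m - 1) e"
  shows "P_eps m e \<in> curve_V m"
proof -
  let ?x = "\<lambda>i. if i \<in> {1..m - 1} then e ^ i else 0"
  have e1: "e ^ (m - 1) = 1" and ne: "\<And>k. 0 < k \<Longrightarrow> k < m - 1 \<Longrightarrow> e ^ k \<noteq> 1"
    using e by (auto simp: primitive_root_of_unity_def)
  have x: "?x \<in> hcoords (m - 1)"
  proof -
    have "?x (m - 1) \<noteq> 0" "m - 1 \<in> {1..m - 1 + 1}" using m e1 by auto
    then show ?thesis unfolding hcoords_def by auto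
  qed
  have sum0: "(\<Sum>i = 1..m. ?x i ^ k) = 0" if k: "k \<in> {1..m - 2}" for k
  proof -
    have ek: "e ^ k \<noteq> 1" using k m by (intro ne) auto
    have "(\<Sum>i = 1..m. ?x i ^ k) = (\<Sum>i = 1..m - 1. (e ^ k) ^ i)"
      using k by (intro sum.mono_neutral_cong_right) (auto simp: power_mult[symmetric] mult.commute)
    also have "\<dots> = (\<Sum>i<m - 1. (e ^ k) ^ Suc i)"
      by (rule sum.reindex_bij_witness[of _ Suc "\<lambda>i. i - 1"]) auto
    also have "\<dots> = e ^ k * (\<Sum>i<m - 1. (e ^ k) ^ i)"
      by (simp add: sum_distrib_left)
    also have "(\<Sum>i<m - 1. (e ^ k) ^ i) = 0"
    proof -
      have "(e ^ k) ^ (m - 1) = 1"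
        by (metis e1 power_mult mult.commute power_one)
      then show ?thesis using ek by (simp add: geometric_sum)
    qed
    finally show ?thesis by simp
  qed
  have "(\<Sum>i = 1..m. y i ^ k) = 0" if "y \<in> P_eps m e" "k \<in> {1..m - 2}" for y k
  proof -
    obtain c where y: "y = (\<lambda>i. c * ?x i)"
      using \<open>y \<in> P_eps m e\<close> by (auto simp: P_eps_def proj_point_def proj_rel_def)
    have "(\<Sum>i = 1..m. y i ^ k) = c ^ k * (\<Sum>i = 1..m. ?x i ^ k)"
      unfolding y power_mult_distrib sum_distrib_left ..
    then show ?thesis using sum0[OF that(2)] by simp
  qed
  moreover have "P_eps m e \<in> proj_space (m - 1)"
    using x unfolding P_eps_def proj_point_def proj_space_def by (rule quotientI)
  ultimately show ?thesis by (auto simp: curve_V_def)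
qed

end

theory Submission
  imports Defs
begin

text \<open>
  Newton's identities show that a point of the curve has coordinates \<open>x\<^sub>1, \<dots>, x\<^sub>m\<close> with
  \<open>\<Prod>(T - x\<^sub>i) = T\<^sup>m + a T + b\<close>. Summing this over the roots \<open>x\<^sub>i\<close> turns the additional
  equation into \<open>m b = 0\<close>, hence \<open>b = 0\<close>. If \<open>c\<close> is a nonzero coordinate, the roots of
  \<open>T\<^sup>m + a T\<close> include the \<open>m\<close> distinct elements \<open>0, c \<epsilon>, \<dots>, c \<epsilon>\<^sup>m\<^sup>-\<^sup>1\<close>, so these are the
  coordinates of the point up to a permutation.
\<close>

section \<open>Newton's identities and the trinomial with given roots\<close>

lemma degree_prod_linear:
  fixes x :: "'b \<Rightarrow> 'a::idom"
  shows "degree (\<Prod>i\<in>A. [:- x i, 1:]) = card A"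
  by (subst degree_prod_eq_sum_degree) auto

text \<open>Newton's identities, obtained from the derivative: it is the sum of the cofactors of the
  linear factors, and dividing the product by each linear factor expresses these cofactors through
  its coefficients and the power sums. What remains is \<open>(card A - j) * coeff F j = 0\<close>,
  where \<open>0 < card A - j < card A\<close> lets \<open>ne\<close> finish.\<close>

lemma coeff_prod_linear_eq_0:
  fixes x :: "'b \<Rightarrow> 'a::idom"
  assumes A: "finite A"
    and ne: "\<And>n. 0 < n \<Longrightarrow> n < card A \<Longrightarrow> (of_nat n :: 'a) \<noteq> 0"
    and p: "\<And>k. 1 \<le> k \<Longrightarrow> k + 2 \<le> card A \<Longrightarrow> (\<Sum>i\<in>A. x i ^ k) = 0"
    and j: "2 \<le> j" "j < card A"
  shows "coeff (\<Prod>i\<in>A. [:- x i, 1:]) j = 0"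
proof -
  define F where "F = (\<Prod>i\<in>A. [:- x i, 1:])"
  define Q where "Q i = (\<Prod>l\<in>A - {i}. [:- x l, 1:])" for i
  \<comment> \<open>The weight \<open>x i ^ r\<close> is carried along because comparing
    coefficients in \<open>F = [:- x i, 1:] * Q i\<close> trades a lower degree \<open>j\<close> for
    one more factor \<open>x i\<close>.\<close>
  define S where "S j r = (\<Sum>i\<in>A. x i ^ r * coeff (Q i) j)" for j r
  have F: "F = [:- x i, 1:] * Q i" if "i \<in> A" for i
    unfolding F_def Q_def using A that by (simp add: prod.remove)
  have rec: "S j r = coeff F (Suc j) * (\<Sum>i\<in>A. x i ^ r) + S (Suc j) (Suc r)" for j r
  proof -
    have "x i ^ r * coeff (Q i) j =
        coeff F (Suc j) * x i ^ r + x i ^ Suc r * coeff (Q i) (Suc j)" if "i \<in> A" for i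
      unfolding F[OF that] by (simp add: algebra_simps)
    then show ?thesis
      by (simp only: S_def sum_distrib_left sum.distrib cong: sum.cong)
  qed
  have high: "S j r = 0" if "card A \<le> j" for j r
  proof -
    have "coeff (Q i) j = 0" if i: "i \<in> A" for i
    proof (rule coeff_eq_0)
      have "card (A - {i}) < card A"
        by (rule card_Diff1_less[OF A i])
      then show "degree (Q i) < j"
        unfolding Q_def degree_prod_linear using \<open>card A \<le> j\<close> by linarith
    qed
    then show ?thesis by (simp add: S_def)
  qed
  \<comment> \<open>Unrolling \<open>rec\<close> raises both indices and keeps \<open>r < j\<close>
    until \<open>j\<close> reaches \<open>card A\<close>. Before that, \<open>r < j < card A\<close>
    gives \<open>r + 2 \<le> card A\<close>, so each power sum met is zero by
    \<open>p\<close>.\<close>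
  have S0: "S j r = 0" if "1 \<le> r" "r < j" for j r
    using that
  proof (induction "card A - j" arbitrary: j r)
    case 0
    then show ?case by (intro high) simp
  next
    case (Suc d)
    have "S (Suc j) (Suc r) = 0"
      using Suc.hyps(2) Suc.prems by (intro Suc.hyps(1)) auto
    moreover have "(\<Sum>i\<in>A. x i ^ r) = 0"
      using Suc.hyps(2) Suc.prems by (intro p) auto
    ultimately show ?case by (subst rec) simp
  qed
  obtain n where n: "j = Suc n" "1 \<le> n"
    using j by (cases j) auto
  have "pderiv F = (\<Sum>i\<in>A. Q i)"
    unfolding F_def Q_def pderiv_prod by (simp add: pderiv_pCons)
  then have "of_nat j * coeff F j = S n 0"
    unfolding n S_def by (metis (no_types, lifting) coeff_pderiv coeff_sum mult_1 power_0 sum.cong)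
  \<comment> \<open>For \<open>r = 0\<close> the power sum in \<open>rec\<close> just counts
    \<open>A\<close>; the remainder \<open>S j 1\<close> vanishes since
    \<open>j \<ge> 2\<close>.\<close>
  also have "\<dots> = of_nat (card A) * coeff F j"
    using rec[of n 0] S0[of 1 "Suc n"] n by (simp add: mult.commute)
  finally have "of_nat (card A - j) * coeff F j = 0"
    using j by (auto simp: of_nat_diff algebra_simps)
  then show ?thesis
    unfolding F_def using ne[of "card A - j"] j by simp
qed

lemma poly_prod_linear_trinomial:
  fixes x :: "'b \<Rightarrow> 'a::idom"
  assumes A: "finite A" "2 \<le> card A"
    and ne: "\<And>n. 0 < n \<Longrightarrow> n < card A \<Longrightarrow> (of_nat n :: 'a) \<noteq> 0"
    and p: "\<And>k. 1 \<le> k \<Longrightarrow> k + 2 \<le> card A \<Longrightarrow> (\<Sum>i\<in>A. x i ^ k) = 0"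
  obtains a b where "\<And>t. (\<Prod>i\<in>A. t - x i) = t ^ card A + a * t + b"
proof -
  define F where "F = (\<Prod>i\<in>A. [:- x i, 1:])"
  have deg: "degree F = card A"
    unfolding F_def by (rule degree_prod_linear)
  have lead: "coeff F (card A) = 1"
    unfolding deg[symmetric] F_def lead_coeff_prod by simp
  have "(\<Prod>i\<in>A. t - x i) = t ^ card A + coeff F 1 * t + coeff F 0" for t
  proof -
    have "(\<Prod>i\<in>A. t - x i) = poly F t"
      unfolding F_def poly_prod by simp
    also have "\<dots> = (\<Sum>j\<le>card A. coeff F j * t ^ j)"
      by (simp add: poly_altdef deg)
    also have "\<dots> = (\<Sum>j\<in>{0, 1, card A}. coeff F j * t ^ j)"
    proof (rule sum.mono_neutral_right)
      show "\<forall>j\<in>{..card A} - {0, 1, card A}. coeff F j * t ^ j = 0"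
        unfolding F_def using coeff_prod_linear_eq_0[OF A(1) ne p] by auto
    qed (use A in auto)
    \<comment> \<open>\<open>2 \<le> card A\<close> keeps the three indices distinct, so no two
      terms merge.\<close>
    also have "\<dots> = t ^ card A + coeff F 1 * t + coeff F 0"
      using A(2) lead by (simp add: numeral_2_eq_2)
    finally show ?thesis .
  qed
  then show ?thesis by (rule that)
qed

section \<open>Recovering the coordinates from roots of unity\<close>

lemma primitive_root_power_inj_on:
  fixes e :: "'a::field"
  assumes "primitive_root_of_unity n e"
  shows "inj_on (\<lambda>i. e ^ i) {1..n}"
proof -
  have e0: "e \<noteq> 0" using assms
    by (metis power_0_left primitive_root_of_unity_def less_numeral_extra(3) zero_neq_one)
  have "e ^ i \<noteq> e ^ j" if "i < j" "i \<in> {1..n}" "j \<in> {1..n}" for i j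
  proof
    assume "e ^ i = e ^ j"
    also have "e ^ j = e ^ i * e ^ (j - i)"
      using that by (simp flip: power_add)
    finally have "e ^ (j - i) = 1" using e0 by simp
    moreover have "0 < j - i" "j - i < n" using that by auto
    ultimately show False
      using assms by (auto simp: primitive_root_of_unity_def)
  qed
  then show ?thesis by (metis inj_onI linorder_neqE_nat)
qed

text \<open>The harder inclusion for a representative vector. Invertibility is required up to
  \<open>n = m\<close>: the smaller values serve Newton's identities, and \<open>m\<close> itself is
  cancelled to get \<open>b = 0\<close>.\<close>

lemma power_sums_zero_permutes:
  fixes x :: "nat \<Rightarrow> 'a::field"
  assumes m: "3 \<le> m"
    and e: "primitive_root_of_unity (m - 1) e"
    and ne: "\<And>n. 0 < n \<Longrightarrow> n \<le> m \<Longrightarrow> (of_nat n :: 'a) \<noteq> 0"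
    and p: "\<And>k. 1 \<le> k \<Longrightarrow> k \<le> m - 2 \<Longrightarrow> (\<Sum>i = 1..m. x i ^ k) = 0"
    and pm: "(\<Sum>i = 1..m. x i ^ m) = 0"
    and x: "x \<in> hcoords (m - 1)"
  obtains \<sigma> c where "\<sigma> permutes {1..m}" "c \<noteq> 0"
    "x = (\<lambda>i. c * (if i \<in> {1..m - 1} then e ^ i else 0)) \<circ> \<sigma>"
proof -
  have m1: "m - 1 + 1 = m" using m by simp
  have card: "card {1..m} = m" by simp
  obtain a b where ab: "\<And>t. (\<Prod>i = 1..m. t - x i) = t ^ m + a * t + b"
    using poly_prod_linear_trinomial[of "{1..m}" x, unfolded card] m ne p by auto
  have root: "x i ^ m + a * x i + b = 0" if "i \<in> {1..m}" for i
    unfolding ab[symmetric] using that by (intro prod_zero) auto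
  have "0 = (\<Sum>i = 1..m. x i ^ m + a * x i + b)"
    using root by simp
  also have "\<dots> = of_nat m * b"
    using pm p[of 1] m by (simp add: sum.distrib flip: sum_distrib_left)
  finally have b: "b = 0" using ne[of m] m by simp
  obtain i\<^sub>0 where i0: "i\<^sub>0 \<in> {1..m}" "x i\<^sub>0 \<noteq> 0"
    using x unfolding hcoords_def m1 by blast
  define c where "c = x i\<^sub>0"
  have c: "c \<noteq> 0" "c ^ m + a * c = 0"
    using i0 root[OF i0(1)] b by (auto simp: c_def)
  \<comment> \<open>The candidate roots; the value 0 at index \<open>m\<close> is one of
    them.\<close>
  define y where "y i = c * (if i \<in> {1..m - 1} then e ^ i else 0)" for i
  have em: "e ^ (m - 1) = 1" using e by (simp add: primitive_root_of_unity_def)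
  have e0: "e \<noteq> 0" using em m by (auto simp: power_0_left)
  have em': "e ^ m = e"
    using em m by (metis m1 power_add power_one_right mult_1)
  have inj: "inj_on y {1..m}"
  proof -
    have "{1..m} = insert m {1..m - 1}" using m by auto
    then show ?thesis
      using primitive_root_power_inj_on[OF e] c(1) e0 m by (auto simp: y_def inj_on_def)
  qed
  have "y j \<in> x ` {1..m}" for j
  proof -
    \<comment> \<open>As \<open>e ^ m = e\<close>, multiplying the root \<open>c\<close> by
      \<open>e ^ j\<close> only multiplies the value of the trinomial by
      \<open>e ^ j\<close>.\<close>
    have "y j ^ m + a * y j = (if j \<in> {1..m - 1} then e ^ j * (c ^ m + a * c) else 0)"
    proof -
      have "(e ^ j) ^ m = e ^ j" by (metis em' power_mult mult.commute)
      then show ?thesis using m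
        by (simp add: y_def power_mult_distrib algebra_simps)
    qed
    then have "(\<Prod>i = 1..m. y j - x i) = 0"
      unfolding ab b c by simp
    then show ?thesis by auto
  qed
  then have sub: "y ` {1..m} \<subseteq> x ` {1..m}" by blast
  \<comment> \<open>Counting: \<open>y\<close> already takes \<open>m\<close> distinct values, and
    \<open>x\<close> can take no more. So the images agree and \<open>x\<close> is injective
    too.\<close>
  have "card (x ` {1..m}) \<le> card (y ` {1..m})"
    using card_image[OF inj] card_image_le[of "{1..m}" x] by simp
  then have img: "y ` {1..m} = x ` {1..m}"
    by (intro card_seteq sub) auto
  then have "inj_on x {1..m}"
    using card_image[OF inj] by (intro eq_card_imp_inj_on) auto
  then have x_bij: "bij_betw x {1..m} (y ` {1..m})"
    using img by (simp add: bij_betw_def)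
  \<comment> \<open>Each coordinate is matched with the index at which \<open>y\<close> takes that
    value. Outside \<open>{1..m}\<close> the identity works, both vectors being zero there.\<close>
  define \<sigma> where "\<sigma> i = (if i \<in> {1..m} then inv_into {1..m} y (x i) else i)" for i
  have "bij_betw (inv_into {1..m} y \<circ> x) {1..m} {1..m}"
    by (rule bij_betw_trans[OF x_bij]) (use inj in \<open>simp add: bij_betw_inv_into inj_on_imp_bij_betw\<close>)
  then have "bij_betw \<sigma> {1..m} {1..m}"
    by (subst bij_betw_cong[of _ _ "inv_into {1..m} y \<circ> x"]) (auto simp: \<sigma>_def)
  then have "\<sigma> permutes {1..m}"
    by (intro bij_imp_permutes) (auto simp: \<sigma>_def)
  moreover have "x i = y (\<sigma> i)" for i
  proof (cases "i \<in> {1..m}")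
    case True
    then show ?thesis
      using img by (simp add: \<sigma>_def f_inv_into_f)
  next
    case False
    then have "x i = 0" using x unfolding hcoords_def m1 by simp
    then show ?thesis using False by (auto simp: \<sigma>_def y_def)
  qed
  ultimately show ?thesis
    using that[of \<sigma> c] c(1) by (auto simp: y_def o_def)
qed

section \<open>Permutations acting on projective points and hypersurfaces\<close>

lemma proj_point_eq:
  "x \<in> hcoords n \<Longrightarrow> proj_point n x = {(\<lambda>i. c * x i) |c. c \<noteq> 0}"
  by (auto simp: proj_point_def proj_rel_def hcoords_def)

lemma proj_point_scale:
  assumes "x \<in> hcoords n" "c \<noteq> 0"
  shows "proj_point n (\<lambda>i. c * x i) = proj_point n x"
proof -
  have "(x, \<lambda>i. c * x i) \<in> proj_rel n"
    using assms by (auto simp: proj_rel_def hcoords_def)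
  then show ?thesis
    unfolding proj_point_def using equiv_class_eq[OF equiv_proj_rel] by metis
qed

lemma permute_proj_point:
  fixes x :: "nat \<Rightarrow> 'a::field"
  assumes "m \<ge> 1" "\<sigma> permutes {1..m}" "x \<in> hcoords (m - 1)"
  shows "(\<lambda>z. z \<circ> \<sigma>) ` proj_point (m - 1) x = proj_point (m - 1) (x \<circ> \<sigma>)"
  unfolding proj_point_eq[OF assms(3)] proj_point_eq[OF permute_hcoords[OF assms]]
  by (auto simp: o_def image_iff)

lemma permute_fermat_hypersurface:
  fixes P :: "(nat \<Rightarrow> 'a::field) set"
  assumes m: "m \<ge> 1" and \<sigma>: "\<sigma> permutes {1..m}" and P: "P \<in> fermat_hypersurface m k"
  shows "(\<lambda>x. x \<circ> \<sigma>) ` P \<in> fermat_hypersurface m k"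
proof -
  have "(\<Sum>i = 1..m. (x \<circ> \<sigma>) i ^ k) = (\<Sum>i = 1..m. x i ^ k)" for x :: "nat \<Rightarrow> 'a"
    using sum.permute[OF \<sigma>, of "\<lambda>i. x i ^ k"] by (simp add: o_def)
  then show ?thesis
    using P permute_proj_space[OF m \<sigma>] by (auto simp: fermat_hypersurface_def)
qed

text \<open>The coordinates are 0 or \<open>c\<close> times an \<open>(m - 1)\<close>-th root of
  unity, so their \<open>m\<close>-th powers are one common multiple of the coordinates themselves,
  whose sum vanishes on the curve.\<close>

lemma P_eps_in_fermat_hypersurface:
  fixes e :: "'a::field"
  assumes m: "m \<ge> 5" and e: "primitive_root_of_unity (m - 1) e"
  shows "P_eps m e \<in> fermat_hypersurface m m"
proof -
  have V: "P_eps m e \<in> curve_V m" by (rule P_eps_in_curve_V[OF m e])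
  have "\<exists>d. \<forall>i. x i ^ m = d * x i" if x: "x \<in> P_eps m e" for x
  proof -
    obtain c where c: "x = (\<lambda>i. c * (if i \<in> {1..m - 1} then e ^ i else 0))"
      using x by (auto simp: P_eps_def proj_point_def proj_rel_def)
    have "x i ^ m = c ^ (m - 1) * x i" for i
    proof -
      have "e ^ (m - 1) = 1" using e by (simp add: primitive_root_of_unity_def)
      then have "(e ^ i) ^ (m - 1) = 1" by (metis power_mult mult.commute power_one)
      moreover have "x i ^ m = x i ^ (m - 1) * x i"
        using m by (simp add: power_eq_if)
      ultimately show ?thesis using m by (simp add: c power_mult_distrib)
    qed
    then show ?thesis by blast
  qed
  moreover have "(\<Sum>i = 1..m. x i) = 0" if "x \<in> P_eps m e" for x
  proof -
    have "1 \<in> {1..m - 2}" using m by simp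
    then have "(\<Sum>i = 1..m. x i ^ 1) = 0" using V that unfolding curve_V_def by blast
    then show ?thesis by simp
  qed
  ultimately have "(\<Sum>i = 1..m. x i ^ m) = 0" if "x \<in> P_eps m e" for x
    using that by (metis (no_types, lifting) mult_zero_right sum.cong sum_distrib_left)
  then show ?thesis
    using V by (simp add: curve_V_def fermat_hypersurface_def)
qed

theorem lemma5p3:
  fixes \<epsilon> :: "'a::alg_closed_field" and m :: nat
  assumes "CHAR('a) = 0 \<or> (prime CHAR('a) \<and> CHAR('a) \<ge> 7 \<and> m \<le> CHAR('a) - 1)"
    and "m \<ge> 5"
    and "primitive_root_of_unity (m - 1) \<epsilon>"
  shows "Omega_eps m \<epsilon> = curve_V m \<inter> fermat_hypersurface m m"
proof
  have m: "m \<ge> 1" using assms(2) by simp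
  have eps: "P_eps m \<epsilon> \<in> curve_V m" by (rule P_eps_in_curve_V[OF assms(2,3)])
  \<comment> \<open>Membership of \<open>P_eps\<close> in the curve is what lets the extensional
    \<open>coord_action\<close> unfold to a permutation of coordinates.\<close>
  have Omega: "Omega_eps m \<epsilon> = {(\<lambda>x. x \<circ> inv' \<sigma>) ` P_eps m \<epsilon> |\<sigma>. \<sigma> permutes {1..m}}"
    using eps by (simp add: Omega_eps_def orbit_def coord_action_def sym_group_def)
  show "Omega_eps m \<epsilon> \<subseteq> curve_V m \<inter> fermat_hypersurface m m"
    unfolding Omega
    using permute_curve_V[OF m permutes_inv eps]
      permute_fermat_hypersurface[OF m permutes_inv P_eps_in_fermat_hypersurface[OF assms(2,3)]]
    by blast
  show "curve_V m \<inter> fermat_hypersurface m m \<subseteq> Omega_eps m \<epsilon>"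
  proof
    fix P :: "(nat \<Rightarrow> 'a) set" assume P: "P \<in> curve_V m \<inter> fermat_hypersurface m m"
    then obtain x where x: "x \<in> hcoords (m - 1)" "P = proj_point (m - 1) x"
      by (auto simp: curve_V_def proj_space_def quotient_def proj_point_def)
    have "x \<in> P"
      unfolding x(2) proj_point_def by (rule equiv_class_self[OF equiv_proj_rel x(1)])
    then have pk: "(\<Sum>i = 1..m. x i ^ k) = 0" if "1 \<le> k" "k \<le> m - 2" for k
      using P that by (auto simp: curve_V_def)
    have pm: "(\<Sum>i = 1..m. x i ^ m) = 0"
      using P \<open>x \<in> P\<close> by (auto simp: fermat_hypersurface_def)
    \<comment> \<open>Zero divides no positive \<open>n\<close>, and a prime characteristic exceeds
      \<open>m\<close>.\<close>
    have ne: "(of_nat n :: 'a) \<noteq> 0" if "0 < n" "n \<le> m" for n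
    proof -
      have "\<not> CHAR('a) dvd n"
        using assms(1) that by (auto dest: dvd_imp_le)
      then show ?thesis by (simp add: of_nat_eq_0_iff_char_dvd)
    qed
    let ?e = "\<lambda>i. if i \<in> {1..m - 1} then \<epsilon> ^ i else 0"
    obtain \<sigma> c where \<sigma>: "\<sigma> permutes {1..m}" and c: "c \<noteq> 0"
      and x_eq: "x = (\<lambda>i. c * ?e i) \<circ> \<sigma>"
      using power_sums_zero_permutes[OF _ assms(3) ne pk pm x(1)] assms(2) by auto
    have e: "?e \<in> hcoords (m - 1)"
    proof -
      have "?e (m - 1) \<noteq> 0"
        using assms(2,3) by (simp add: primitive_root_of_unity_def)
      moreover have "m - 1 \<in> {1..m - 1 + 1}" using assms(2) by simp
      ultimately show ?thesis unfolding hcoords_def by auto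
    qed
    have "P = proj_point (m - 1) (\<lambda>i. c * (?e \<circ> \<sigma>) i)"
      unfolding x(2) x_eq by (simp add: o_def)
    also have "\<dots> = proj_point (m - 1) (?e \<circ> \<sigma>)"
      by (rule proj_point_scale[OF permute_hcoords[OF m \<sigma> e] c])
    \<comment> \<open>The action composes with the inverse, so the group element carrying
      \<open>P_eps\<close> to \<open>P\<close> is \<open>inv' \<sigma>\<close>.\<close>
    also have "\<dots> = (\<lambda>z. z \<circ> inv' (inv' \<sigma>)) ` P_eps m \<epsilon>"
      unfolding P_eps_def permutes_inv_inv[OF \<sigma>] by (rule permute_proj_point[OF m \<sigma> e, symmetric])
    finally show "P \<in> Omega_eps m \<epsilon>"
      unfolding Omega using permutes_inv[OF \<sigma>] by blast
  qed
qed

end
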